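(* Let $G=(V,E)$ be a finite graph, and for each vertex $v\in V$ let $d_v$ denote the degree of $v$. Let $\underline{r}=(r_v)_{v\in V}$ be a vector of non-negative integers, and let $\mathrm{e}_{\underline{r}}(G)$ denote the number of orientations of $G$ in which the in-degree of every vertex $v$ is exactly $r_v$. Then $$\mathrm{e}_{\underline{r}}(G)\geq \prod_{v\in V}\binom{d_v}{r_v}\bigg(\frac{r_v}{d_v}\bigg)^{r_v}\bigg(\frac{d_v-r_v}{d_v}\bigg)^{d_v-r_v}\cdot \inf_{x_u>0,\ u\in V}\frac{\prod_{(u,v)\in E}(x_u+x_v)}{\prod_{u\in V}x_u^{r_u}}.$$
   Context: An orientation of $G$ assigns to each edge one of its two directions; the in-degree of a vertex is the number of edges directed towards it. The infimum is over all assignments of positive real numbers $x_u$ to the vertices $u\in V$. The convention $0^0=1$ is used in the product. *)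

theory Defs
  imports Complex_Main "HOL-Library.FuncSet"
begin

text \<open>
  A finite graph on the vertex set \<open>V\<close> with edge set \<open>E\<close>: the edge \<open>e\<close> joins the two vertices in
  \<open>ends e\<close>. Parallel edges are allowed, loops are not. Simple graphs are the special case in
  which \<open>E\<close> is a set of two-element subsets of \<open>V\<close> and \<open>ends\<close> is the identity.
\<close>

locale finite_graph =
  fixes V :: "'v set" and E :: "'e set" and ends :: "'e \<Rightarrow> 'v set"
  assumes finite_verts: "finite V"
    and finite_edges: "finite E"
    and ends_subset: "e \<in> E \<Longrightarrow> ends e \<subseteq> V"
    and card_ends: "e \<in> E \<Longrightarrow> card (ends e) = 2"

definition vertex_degree :: "'e set \<Rightarrow> ('e \<Rightarrow> 'v set) \<Rightarrow> 'v \<Rightarrow> nat" where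
  "vertex_degree E ends v = card {e \<in> E. v \<in> ends e}"

text \<open>
  A direction of an edge is a pair (tail, head). Orientations are extensional functions on
  \<open>E\<close>, so that distinct elements of this set are distinct orientations.
\<close>

definition orientations :: "'e set \<Rightarrow> ('e \<Rightarrow> 'v set) \<Rightarrow> ('e \<Rightarrow> 'v \<times> 'v) set" where
  "orientations E ends = (\<Pi>\<^sub>E e\<in>E. {(u, v). ends e = {u, v}})"

definition indegree :: "'e set \<Rightarrow> ('e \<Rightarrow> 'v \<times> 'v) \<Rightarrow> 'v \<Rightarrow> nat" where
  "indegree E ori v = card {e \<in> E. snd (ori e) = v}"

definition num_orientations ::
    "'v set \<Rightarrow> 'e set \<Rightarrow> ('e \<Rightarrow> 'v set) \<Rightarrow> ('v \<Rightarrow> nat) \<Rightarrow> nat" where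
  "num_orientations V E ends r =
     card {ori \<in> orientations E ends. \<forall>v\<in>V. indegree E ori v = r v}"

end

theory Submission
  imports Defs "HOL-Computational_Algebra.Computational_Algebra" "HOL-Library.Nonpos_Ints"
begin

text \<open>
  The product over the edges is the generating function of the orientations by in-degrees, a
  homogeneous polynomial without zeros when all variables lie in the right half-plane. The
  coefficient of a power of one variable inherits this stability: \<open>d/dt + \<epsilon>\<close> preserves it, and the
  coefficient is a limit, as \<open>\<epsilon>\<close> tends to \<open>0\<close>, of iterates evaluated at \<open>t = \<epsilon>\<close>. Fixing
  positive values of the other variables, stability and homogeneity make a polynomial in one
  variable real-rooted, so Newton's inequalities bound its coefficients below by its capacity.
  Extracting the vertices one at a time (Gurvits) gives one factor of the product per vertex.
\<close>

subsection \<open>Coefficients of polynomials that are stable in the right half-plane\<close>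

lemma complex_poly_linear_factor:
  fixes p :: "complex poly"
  assumes "degree p > 0"
  obtains a q where "p = [:- a, 1:] * q" "degree p = Suc (degree q)"
proof -
  from assms have "\<not> constant (poly p)"
    by (simp add: constant_degree)
  then obtain a where "poly p a = 0"
    using fundamental_theorem_of_algebra by blast
  then obtain q where q: "p = [:- a, 1:] * q"
    by (auto simp: poly_eq_0_iff_dvd elim: dvdE)
  moreover from q assms have "degree p = Suc (degree q)"
    by (subst q, subst degree_mult_eq) auto
  ultimately show thesis by (rule that)
qed

text \<open>The logarithmic derivative is the sum of \<open>1 / (t - a)\<close> over the roots
  \<open>a\<close>, and each summand has non-negative real part because
  \<open>Re a \<le> 0 < Re t\<close>. The induction peels off one root at a time.\<close>

lemma Re_logderiv_nonneg:
  fixes p :: "complex poly"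
  assumes "\<And>t. Re t > 0 \<Longrightarrow> poly p t \<noteq> 0" and "Re t > 0"
  shows "Re (poly (pderiv p) t / poly p t) \<ge> 0"
  using assms(1)
proof (induction "degree p" arbitrary: p)
  case 0
  then obtain c where "p = [:c:]"
    using degree_eq_zeroE by metis
  then show ?case by (simp add: pderiv_pCons)
next
  case (Suc n)
  then obtain a q where q: "p = [:- a, 1:] * q" "degree p = Suc (degree q)"
    by (metis complex_poly_linear_factor zero_less_Suc)
  have nz: "poly q s \<noteq> 0" "s \<noteq> a" if "Re s > 0" for s
    using Suc.prems[OF that] q(1) by auto
  then have IH: "Re (poly (pderiv q) t / poly q t) \<ge> 0"
    using Suc.hyps q by auto
  have "Re a \<le> 0"
    using nz(2)[of a] by force
  with assms(2) have "Re (1 / (t - a)) \<ge> 0"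
    by (simp add: Re_divide)
  moreover have "poly (pderiv p) t / poly p t = 1 / (t - a) + poly (pderiv q) t / poly q t"
    unfolding q(1) pderiv_mult using nz[OF assms(2)] by (simp add: pderiv_pCons field_simps)
  ultimately show ?case using IH by simp
qed

text \<open>
  Unlike \<open>pderiv\<close> itself, this operator never annihilates a nonzero polynomial when
  \<open>Re c > 0\<close>, so no control of degrees is needed when it is iterated.
\<close>

definition shifted_pderiv :: "complex \<Rightarrow> complex poly \<Rightarrow> complex poly" where
  "shifted_pderiv c p = pderiv p + smult c p"

text \<open>A zero would force the logarithmic derivative to equal \<open>- c\<close>, which has
  negative real part.\<close>

lemma shifted_pderiv_nonzero:
  assumes "\<And>t. Re t > 0 \<Longrightarrow> poly p t \<noteq> 0" "Re c > 0" "Re t > 0"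
  shows "poly (shifted_pderiv c p) t \<noteq> 0"
proof
  assume "poly (shifted_pderiv c p) t = 0"
  then have "poly (pderiv p) t / poly p t = - c"
    using assms(1)[OF assms(3)] by (simp add: shifted_pderiv_def field_simps add_eq_0_iff)
  with Re_logderiv_nonneg[of p t] assms show False by simp
qed

lemma shifted_pderiv_power_nonzero:
  assumes "\<And>t. Re t > 0 \<Longrightarrow> poly p t \<noteq> 0" "Re c > 0" "Re t > 0"
  shows "poly ((shifted_pderiv c ^^ k) p) t \<noteq> 0"
  using assms(3)
proof (induction k arbitrary: t)
  case (Suc k)
  then show ?case
    using shifted_pderiv_nonzero[OF Suc.IH assms(2)] by simp
qed (use assms(1) in simp)

text \<open>Linearity is what later allows the same iterate to be read as a polynomial in a second
  variable on which the scalars \<open>b j\<close> depend.\<close>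

lemma shifted_pderiv_power_sum_smult:
  "(shifted_pderiv c ^^ k) (\<Sum>j\<in>J. smult (b j) (p j)) =
     (\<Sum>j\<in>J. smult (b j) ((shifted_pderiv c ^^ k) (p j)))"
proof (induction k)
  case (Suc k)
  have "pderiv (\<Sum>j\<in>J. smult (b j) (f j)) = (\<Sum>j\<in>J. smult (b j) (pderiv (f j)))" for f
    by (simp add: higher_pderiv_sum[of 1, simplified] pderiv_smult)
  moreover have "smult c (\<Sum>j\<in>J. smult (b j) (f j)) = (\<Sum>j\<in>J. smult (b j) (smult c (f j)))" for f
    by (induction J rule: infinite_finite_induct) (simp_all add: smult_add_right mult.commute)
  ultimately show ?case
    using Suc by (simp add: shifted_pderiv_def sum.distrib smult_add_right)
qed simp

lemma degree_shifted_pderiv_power: "degree ((shifted_pderiv c ^^ k) p) \<le> degree p"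
proof (induction k)
  case (Suc k)
  have "degree (shifted_pderiv c q) \<le> degree q" for q
    unfolding shifted_pderiv_def by (intro degree_add_le) (auto simp: degree_pderiv)
  with Suc show ?case by (force intro: order_trans)
qed simp

text \<open>The operator tends coefficientwise to \<open>pderiv\<close> while the evaluation point
  tends to \<open>0\<close>, so the limit is the \<open>k\<close>-th derivative at \<open>0\<close>.
  Evaluating at \<open>c\<close> rather than at \<open>0\<close> keeps the point inside the open
  half-plane for positive real \<open>c\<close>.\<close>

lemma tendsto_shifted_pderiv_power:
  "((\<lambda>c. poly ((shifted_pderiv c ^^ k) p) c) \<longlongrightarrow> fact k * coeff p k) (at 0)"
proof -
  have lim: "((\<lambda>c. coeff ((shifted_pderiv c ^^ k) p) n) \<longlongrightarrow> coeff ((pderiv ^^ k) p) n) (at 0)" for n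
  proof (induction k arbitrary: n)
    case (Suc k)
    have "((\<lambda>c. of_nat (Suc n) * coeff ((shifted_pderiv c ^^ k) p) (Suc n)
             + c * coeff ((shifted_pderiv c ^^ k) p) n)
          \<longlongrightarrow> of_nat (Suc n) * coeff ((pderiv ^^ k) p) (Suc n) + 0 * coeff ((pderiv ^^ k) p) n) (at 0)"
      by (intro tendsto_intros Suc)
    then show ?case
      by (simp add: shifted_pderiv_def[of _ "(shifted_pderiv _ ^^ k) p"] coeff_pderiv)
  qed simp
  \<comment> \<open>The range of summation does not depend on \<open>c\<close>, so the limit can be
    taken term by term.\<close>
  have "((\<lambda>c. \<Sum>n\<le>degree p. coeff ((shifted_pderiv c ^^ k) p) n * c ^ n)
          \<longlongrightarrow> (\<Sum>n\<le>degree p. coeff ((pderiv ^^ k) p) n * 0 ^ n)) (at 0)"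
    by (intro tendsto_intros lim)
  moreover have "poly ((shifted_pderiv c ^^ k) p) c
      = (\<Sum>n\<le>degree p. coeff ((shifted_pderiv c ^^ k) p) n * c ^ n)" for c
    unfolding poly_altdef using degree_shifted_pderiv_power[of k c p]
    by (intro sum.mono_neutral_left) (auto simp: coeff_eq_0)
  moreover have "(\<Sum>n\<le>degree p. coeff ((pderiv ^^ k) p) n * 0 ^ n) = fact k * coeff p k"
    by (simp add: sum.delta power_0_left if_distrib coeff_higher_pderiv pochhammer_fact
          cong: if_cong)
  ultimately show ?thesis by simp
qed

section \<open>Limits of polynomials without zeros in a disc\<close>

text \<open>
  An elementary substitute for Hurwitz's theorem: the bound survives a pointwise limit of
  polynomials of bounded degree, so a limit that vanishes at \<open>0\<close> vanishes near \<open>0\<close>.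
\<close>

lemma norm_poly_le_if_no_roots_near_0:
  fixes p :: "complex poly"
  assumes "\<And>w. norm w < \<delta> \<Longrightarrow> poly p w \<noteq> 0" "degree p \<le> n" "norm w < \<delta>"
  shows "norm (poly p w) \<le> 2 ^ n * norm (poly p 0)"
  using assms(1,2)
proof (induction n arbitrary: p)
  case 0
  then obtain c where "p = [:c:]"
    using degree_eq_zeroE by (metis le_zero_eq)
  then show ?case by simp
next
  case (Suc n)
  show ?case
  proof (cases "degree p = 0")
    case True
    then have "norm (poly p w) \<le> 2 ^ n * norm (poly p 0)"
      using Suc by auto
    then show ?thesis
      by (rule order_trans) (simp add: mult_right_mono)
  next
    case False
    then obtain a q where q: "p = [:- a, 1:] * q" "degree p = Suc (degree q)"
      using complex_poly_linear_factor by (metis neq0_conv)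
    then have nz: "poly q s \<noteq> 0" "s \<noteq> a" if "norm s < \<delta>" for s
      using Suc.prems(1)[OF that] by auto
    have "norm (poly q w) \<le> 2 ^ n * norm (poly q 0)"
      using nz Suc q by auto
    \<comment> \<open>The root \<open>a\<close> lies outside the disc, so
      \<open>norm w < \<delta> \<le> norm a\<close>.\<close>
    moreover have "norm (w - a) \<le> 2 * norm (0 - a)"
      using nz(2)[of a] assms(3) norm_triangle_ineq4[of w a] by force
    ultimately have "norm (w - a) * norm (poly q w) \<le> (2 * norm (0 - a)) * (2 ^ n * norm (poly q 0))"
      by (intro mult_mono) auto
    moreover have "poly p s = (s - a) * poly q s" for s
      by (simp add: q(1) algebra_simps)
    ultimately show ?thesis
      by (simp add: norm_mult mult_ac)
  qed
qed

text \<open>Up to the factor \<open>fact k\<close>, the polynomial \<open>a k\<close> is a pointwise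
  limit of polynomials of bounded degree without zeros in the disc. If it vanished at
  \<open>0\<close>, it would vanish on the whole disc and hence be zero.\<close>

lemma coeff_nonzero_if_half_plane_stable:
  fixes a :: "nat \<Rightarrow> complex poly"
  assumes "\<delta> > 0" "k \<le> d" "a k \<noteq> 0"
    and nz: "\<And>w t. norm w < \<delta> \<Longrightarrow> Re t > 0 \<Longrightarrow> (\<Sum>j\<le>d. poly (a j) w * t ^ j) \<noteq> 0"
  shows "poly (a k) 0 \<noteq> 0"
proof
  assume a0: "poly (a k) 0 = 0"
  \<comment> \<open>\<open>P w\<close> is the polynomial in \<open>t\<close> for fixed
    \<open>w\<close>. \<open>G c\<close> is a polynomial in \<open>w\<close>: the iterated operator
    acts on \<open>t\<close>, and then \<open>t = c\<close> is substituted.\<close>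
  define P where "P w = (\<Sum>j\<le>d. smult (poly (a j) w) (monom 1 j))" for w
  define G where "G c = (\<Sum>j\<le>d. smult (poly ((shifted_pderiv c ^^ k) (monom 1 j)) c) (a j))" for c
  define n where "n = (MAX j\<in>{..d}. degree (a j))"
  have coeff_P: "coeff (P w) k = poly (a k) w" for w
    using assms(2) by (simp add: P_def coeff_sum if_distrib sum.delta cong: if_cong)
  have G: "poly (G c) w = poly ((shifted_pderiv c ^^ k) (P w)) c" for c w
    by (simp add: G_def P_def shifted_pderiv_power_sum_smult poly_sum mult.commute)
  have deg: "degree (G c) \<le> n" for c
    unfolding G_def n_def
    by (intro degree_sum_le) (auto intro: order_trans[OF degree_smult_le] Max_ge)
  have lim: "((\<lambda>x. poly (G (of_real x)) w) \<longlongrightarrow> fact k * poly (a k) w) (at_right (0::real))" for w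
    unfolding G coeff_P[symmetric]
    by (rule filterlim_compose[OF tendsto_shifted_pderiv_power])
       (auto simp: filterlim_at eventually_at_filter intro!: tendsto_eq_intros)
  have "poly (a k) w = 0" if w: "norm w < \<delta>" for w
  proof -
    have "eventually (\<lambda>x::real. norm (poly (G (of_real x)) w) \<le> 2 ^ n * norm (poly (G (of_real x)) 0)) (at_right 0)"
    proof (rule eventually_at_right_less[THEN eventually_mono])
      fix x :: real assume x: "0 < x"
      have "poly (G (of_real x)) s \<noteq> 0" if "norm s < \<delta>" for s
        unfolding G
        by (rule shifted_pderiv_power_nonzero)
           (use nz[OF that] x in \<open>auto simp: P_def poly_sum poly_monom\<close>)
      then show "norm (poly (G (of_real x)) w) \<le> 2 ^ n * norm (poly (G (of_real x)) 0)"
        by (intro norm_poly_le_if_no_roots_near_0[OF _ deg w])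
    qed
    then have "norm (fact k * poly (a k) w) \<le> 2 ^ n * norm (fact k * poly (a k) 0)"
      by (rule tendsto_le[OF trivial_limit_at_right_real tendsto_mult_left[OF tendsto_norm[OF lim]]
            tendsto_norm[OF lim]])
    then show ?thesis by (simp add: a0)
  qed
  then have "of_real ` {0<..<\<delta>} \<subseteq> {w. poly (a k) w = 0}"
    by auto
  moreover have "infinite ((of_real :: real \<Rightarrow> complex) ` {0<..<\<delta>})"
    using assms(1) by (simp add: finite_image_iff inj_on_def infinite_Ioo)
  ultimately show False
    using poly_roots_finite[OF assms(3)] finite_subset by blast
qed

subsection \<open>Newton's inequalities and the capacity of real-rooted polynomials\<close>

text \<open>In this normalization Newton's inequalities say that the sequence is log-concave. For
  \<open>j > d\<close> the value is \<open>0\<close>, as a quotient by zero.\<close>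

definition normalized_coeff :: "nat \<Rightarrow> real poly \<Rightarrow> nat \<Rightarrow> real" where
  "normalized_coeff d p j = coeff p j / real (d choose j)"

text \<open>Both coefficients of a factor are kept, instead of a root: \<open>(1, 0)\<close> is then
  allowed as a root at infinity, so that the list may be longer than the degree.\<close>

definition linear_product :: "(real \<times> real) list \<Rightarrow> real poly" where
  "linear_product l = (\<Prod>(a, b)\<leftarrow>l. [:a, b:])"

lemma linear_product_Nil: "linear_product [] = 1"
  and linear_product_Cons: "linear_product (c # l) = [:fst c, snd c:] * linear_product l"
  by (simp_all add: linear_product_def case_prod_beta)

lemma coeff_linear_mult_Suc:
  "coeff ([:a, b:] * p) (Suc j) = a * coeff p (Suc j) + b * coeff p j"
  by simp

lemma degree_linear_product: "degree (linear_product l) \<le> length l"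
proof (induction l)
  case (Cons c l)
  have "degree (linear_product (c # l)) \<le> degree [:fst c, snd c:] + degree (linear_product l)"
    unfolding linear_product_Cons by (rule degree_mult_le)
  also have "\<dots> \<le> length (c # l)"
    using Cons by simp
  finally show ?case .
qed (simp add: linear_product_Nil)

lemma coeff_linear_product_pos:
  assumes "\<forall>c\<in>set l. fst c > 0 \<and> snd c > 0" "j \<le> length l"
  shows "coeff (linear_product l) j > 0"
  using assms
proof (induction l arbitrary: j)
  case (Cons c l)
  have nn: "coeff (linear_product l) i \<ge> 0" for i
    using Cons.IH[of i] Cons.prems(1) degree_linear_product[of l]
    by (cases "i \<le> length l") (auto simp: coeff_eq_0 less_imp_le)
  show ?case
  proof (cases j)
    case 0
    then show ?thesis using Cons.IH[of 0] Cons.prems by (simp add: linear_product_Cons)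
  next
    case (Suc i)
    then have "snd c * coeff (linear_product l) i > 0"
      using Cons.IH[of i] Cons.prems by simp
    moreover have "fst c * coeff (linear_product l) j \<ge> 0"
      using nn Cons.prems(1) by (simp add: less_imp_le)
    ultimately show ?thesis
      using Suc by (simp add: linear_product_Cons)
  qed
qed (simp add: linear_product_Nil)

text \<open>
  The four numbers stand for consecutive normalized coefficients, and the two sides come from
  multiplication by a linear factor, see \<open>normalized_coeff_linear_mult\<close>.
\<close>

lemma newton_ineq_step:
  fixes A B C D s t :: real
  assumes "A * C \<le> B\<^sup>2" "B * D \<le> C\<^sup>2" "B > 0" "C > 0" "A \<ge> 0" "D \<ge> 0"
    and "s \<ge> 1" "t \<ge> 1" "a \<ge> 0" "b \<ge> 0"
  shows "((s + 1) * a * B + (t - 1) * b * A) * ((s - 1) * a * D + (t + 1) * b * C)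
     \<le> (s * a * C + t * b * B)\<^sup>2"
proof -
  have "(A * C) * (B * D) \<le> B\<^sup>2 * C\<^sup>2"
    using assms by (intro mult_mono) simp_all
  then have "(A * D) * (B * C) \<le> (B * C) * (B * C)"
    by (simp add: power2_eq_square mult_ac)
  then have "A * D \<le> B * C"
    using assms by (simp add: mult_le_cancel_right)
  \<comment> \<open>The first two terms are non-negative by the assumed inequalities, the third by
    \<open>A * D \<le> B * C\<close>, and the last is a square.\<close>
  have "(s * a * C + t * b * B)\<^sup>2 -
      ((s + 1) * a * B + (t - 1) * b * A) * ((s - 1) * a * D + (t + 1) * b * C)
    = a\<^sup>2 * ((s\<^sup>2 - 1) * (C\<^sup>2 - B * D)) + b\<^sup>2 * ((t\<^sup>2 - 1) * (B\<^sup>2 - A * C))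
      + a * b * ((s - 1) * (t - 1) * (B * C - A * D)) + (a * C - b * B)\<^sup>2"
    by (simp add: power2_eq_square algebra_simps)
  also have "\<dots> \<ge> 0"
    using assms \<open>A * D \<le> B * C\<close> by (intro add_nonneg_nonneg mult_nonneg_nonneg) simp_all
  finally show ?thesis by simp
qed

lemma mult_divide_eq_if_mult_eq:
  fixes x :: real
  assumes "D * c = s * C" "c > 0" "C > 0"
  shows "D * x / C = s * (x / c)"
proof -
  have "x * (D * c) = x * (s * C)"
    by (simp only: assms(1))
  with assms(2,3) show ?thesis
    by (simp add: frac_eq_eq mult_ac)
qed

text \<open>The absorption identities for binomial coefficients turn the two terms of the product's
  coefficient into these weights. At \<open>j = 0\<close> the truncated index \<open>j - 1\<close>
  is harmless, since its weight is \<open>0\<close>; at \<open>j = Suc d\<close> the other weight is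
  \<open>0\<close>.\<close>

lemma normalized_coeff_linear_mult:
  assumes "j \<le> Suc d" "degree p \<le> d"
  shows "real (Suc d) * normalized_coeff (Suc d) ([:a, b:] * p) j =
    (real (Suc d) - real j) * a * normalized_coeff d p j
      + real j * b * normalized_coeff d p (j - 1)"
proof -
  have L: "real (Suc d) * real (d choose j) = (real (Suc d) - real j) * real (Suc d choose j)"
  proof (cases "j = Suc d")
    case False
    then have "Suc d * (d choose j) = (Suc d - j) * (Suc d choose j)"
      using binomial_absorb_comp[of "Suc d" j] by simp
    then show ?thesis
      using assms(1) by (metis of_nat_diff of_nat_mult)
  qed simp
  have C: "real (Suc d choose j) > 0"
    using assms(1) by simp
  have 1: "real (Suc d) * coeff p j / real (Suc d choose j) = (real (Suc d) - real j) * normalized_coeff d p j"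
  proof (cases "j = Suc d")
    case True
    then show ?thesis using assms(2) by (simp add: coeff_eq_0)
  next
    case False
    then have "real (d choose j) > 0"
      using assms(1) by simp
    with L C show ?thesis
      unfolding normalized_coeff_def by (intro mult_divide_eq_if_mult_eq)
  qed
  show ?thesis
  proof (cases j)
    case 0
    with 1 show ?thesis by (simp add: normalized_coeff_def)
  next
    case (Suc i)
    have "Suc d * (d choose i) = Suc i * (Suc d choose Suc i)"
      using Suc_times_binomial_eq[of d i] by (simp only: mult.commute)
    then have R: "real (Suc d) * real (d choose i) = real j * real (Suc d choose j)"
      unfolding Suc by (metis of_nat_mult)
    have "real (d choose i) > 0"
      using assms(1) Suc by simp
    with R C have 2: "real (Suc d) * coeff p i / real (Suc d choose j) = real j * normalized_coeff d p i"
      unfolding normalized_coeff_def by (intro mult_divide_eq_if_mult_eq)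
    have "real (Suc d) * normalized_coeff (Suc d) ([:a, b:] * p) j =
      a * (real (Suc d) * coeff p j / real (Suc d choose j)) + b * (real (Suc d) * coeff p i / real (Suc d choose j))"
      unfolding normalized_coeff_def Suc coeff_linear_mult_Suc
      by (simp add: add_divide_distrib algebra_simps)
    then show ?thesis
      unfolding 1 2 by (simp add: Suc)
  qed
qed

text \<open>Induction over the factors: multiplication by a linear factor with positive coefficients
  preserves log-concavity, by \<open>newton_ineq_step\<close>.\<close>

lemma newton_inequality:
  assumes "\<forall>c\<in>set l. fst c > 0 \<and> snd c > 0" "Suc (Suc i) \<le> length l"
  defines "b \<equiv> normalized_coeff (length l) (linear_product l)"
  shows "b i * b (Suc (Suc i)) \<le> (b (Suc i))\<^sup>2"
  using assms(1,2) unfolding b_def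
proof (induction l arbitrary: i)
  case (Cons c l)
  define d where "d = length l"
  define b where "b = normalized_coeff d (linear_product l)"
  define b' where "b' = normalized_coeff (Suc d) (linear_product (c # l))"
  have c: "fst c > 0" "snd c > 0" and l: "\<forall>c\<in>set l. fst c > 0 \<and> snd c > 0"
    using Cons.prems(1) by auto
  have i: "i < d" using Cons.prems(2) by (simp add: d_def)
  have rec: "real (Suc d) * b' j = (real (Suc d) - real j) * fst c * b j + real j * snd c * b (j - 1)"
    if "j \<le> Suc d" for j
    unfolding b_def b'_def linear_product_Cons
    by (rule normalized_coeff_linear_mult[OF that]) (simp add: d_def degree_linear_product)
  have pos: "b j > 0" if "j \<le> d" for j
    using coeff_linear_product_pos[OF l] that by (simp add: b_def normalized_coeff_def d_def)
  have top: "b (Suc d) = 0"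
    by (simp add: b_def normalized_coeff_def)
  have nonneg: "b j \<ge> 0" if "j \<le> Suc d" for j
    using pos[of j] top that by (cases "j = Suc d") (auto simp: less_imp_le)
  have lc: "b j * b (Suc (Suc j)) \<le> (b (Suc j))\<^sup>2" if "Suc j \<le> d" for j
  proof (cases "Suc j = d")
    case False
    with that Cons.IH[OF l, of j] show ?thesis by (simp add: b_def d_def)
  qed (simp add: top)
  \<comment> \<open>This is the coefficient before \<open>b i\<close>. At \<open>i = 0\<close> it
    must be \<open>0\<close>, as truncated subtraction would return \<open>b 0\<close> and the
    inequality with \<open>A\<close> could fail.\<close>
  define A where "A = (if i = 0 then 0 else b (i - 1))"
  have A: "A * b (Suc i) \<le> (b i)\<^sup>2" "A \<ge> 0" "real i * snd c * b (i - 1) = real i * snd c * A"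
    using lc[of "i - 1"] nonneg[of "i - 1"] i by (auto simp: A_def)
  \<comment> \<open>These are the weights of the recursion at the middle index \<open>Suc i\<close>;
    at its two neighbours they change by one in opposite directions.\<close>
  define s where "s = real d - real i"
  define t where "t = real (Suc i)"
  have "((s + 1) * fst c * b i + (t - 1) * snd c * A)
      * ((s - 1) * fst c * b (Suc (Suc i)) + (t + 1) * snd c * b (Suc i))
     \<le> (s * fst c * b (Suc i) + t * snd c * b i)\<^sup>2"
    using A(1,2) lc[of i] pos[of i] pos[of "Suc i"] nonneg[of "Suc (Suc i)"] i c
    by (intro newton_ineq_step) (auto simp: s_def t_def)
  moreover have "(s + 1) * fst c * b i + (t - 1) * snd c * A = real (Suc d) * b' i"
    unfolding rec[OF less_imp_le[OF less_SucI[OF i]]] A(3) by (simp add: s_def t_def)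
  moreover have "(s - 1) * fst c * b (Suc (Suc i)) + (t + 1) * snd c * b (Suc i)
      = real (Suc d) * b' (Suc (Suc i))"
    using rec[of "Suc (Suc i)"] i by (simp add: s_def t_def)
  moreover have "s * fst c * b (Suc i) + t * snd c * b i = real (Suc d) * b' (Suc i)"
    using rec[of "Suc i"] i by (simp add: s_def t_def)
  ultimately have "(real (Suc d) * b' i) * (real (Suc d) * b' (Suc (Suc i))) \<le> (real (Suc d) * b' (Suc i))\<^sup>2"
    by simp
  then have "(real (Suc d))\<^sup>2 * (b' i * b' (Suc (Suc i))) \<le> (real (Suc d))\<^sup>2 * (b' (Suc i))\<^sup>2"
    by (simp add: power2_eq_square mult_ac)
  then have "b' i * b' (Suc (Suc i)) \<le> (b' (Suc i))\<^sup>2"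
    by (rule mult_left_le_imp_le) simp
  then show ?case by (simp add: b'_def d_def)
qed simp

text \<open>Successive ratios decrease, so the sequence lies below the geometric one that agrees
  with it at \<open>k\<close> and has a ratio \<open>\<rho>\<close> between those just before and
  just after \<open>k\<close>: a supporting line for the logarithms.\<close>

lemma log_concave_le_geometric:
  fixes b :: "nat \<Rightarrow> real"
  assumes pos: "\<And>j. j \<le> d \<Longrightarrow> b j > 0"
    and lc: "\<And>j. Suc (Suc j) \<le> d \<Longrightarrow> b j * b (Suc (Suc j)) \<le> (b (Suc j))\<^sup>2"
    and "k \<le> d"
  obtains \<rho> where "\<rho> > 0" "\<And>j. j \<le> d \<Longrightarrow> b j * \<rho> ^ k \<le> b k * \<rho> ^ j"
proof -
  define q where "q j = b (Suc j) / b j" for j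
  have q_pos: "q j > 0" if "j < d" for j
    using pos[of j] pos[of "Suc j"] that by (simp add: q_def)
  have q_step: "q (Suc j) \<le> q j" if "Suc j < d" for j
    using pos[of j] pos[of "Suc j"] lc[of j] that by (simp add: q_def field_simps power2_eq_square)
  have q_mono: "q j \<le> q i" if "i \<le> j" "j < d" for i j
    using that
  proof (induction j rule: dec_induct)
    case (step j)
    then show ?case using q_step[of j] by simp
  qed simp
  \<comment> \<open>The ratio after \<open>k\<close> is taken; for \<open>k = d\<close> there is
    none, and the last one, \<open>q (d - 1)\<close>, serves. For \<open>d = 0\<close> any positive
    number would do.\<close>
  define \<rho> where "\<rho> = (if d = 0 then 1 else q (min k (d - 1)))"
  have \<rho>: "\<rho> > 0" "\<And>j. j < k \<Longrightarrow> \<rho> \<le> q j" "\<And>j. k \<le> j \<Longrightarrow> j < d \<Longrightarrow> q j \<le> \<rho>"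
    using q_pos q_mono \<open>k \<le> d\<close> by (auto simp: \<rho>_def)
  have "b j * \<rho> ^ k \<le> b k * \<rho> ^ j" if "k \<le> j" "j \<le> d" for j
    using that
  proof (induction j rule: dec_induct)
    case (step j)
    have "b (Suc j) \<le> b j * \<rho>"
      using \<rho>(3)[of j] pos[of j] step by (simp add: q_def field_simps)
    then have "b (Suc j) * \<rho> ^ k \<le> (b j * \<rho>) * \<rho> ^ k"
      using \<rho>(1) by (intro mult_right_mono) auto
    also have "\<dots> \<le> b k * \<rho> ^ Suc j"
      using step \<rho>(1) by (simp add: mult_ac)
    finally show ?case .
  qed simp
  moreover have "b j * \<rho> ^ k \<le> b k * \<rho> ^ j" if "j \<le> k" for j
    using that
  proof (induction j rule: inc_induct)
    case (step j)
    have "b j * \<rho> \<le> b (Suc j)"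
      using \<rho>(2)[of j] pos[of j] step \<open>k \<le> d\<close> by (simp add: q_def field_simps)
    then have "(b j * \<rho>) * \<rho> ^ k \<le> b (Suc j) * \<rho> ^ k"
      using \<rho>(1) by (intro mult_right_mono) auto
    also have "\<dots> \<le> b k * \<rho> ^ Suc j"
      by (rule step)
    finally have "(b j * \<rho> ^ k) * \<rho> \<le> (b k * \<rho> ^ j) * \<rho>"
      by (simp add: mult_ac)
    then show ?case using \<rho>(1) by simp
  qed simp
  ultimately show thesis
    using that[of \<rho>] \<rho>(1) by (meson linear)
qed

text \<open>The best choice is the minimizer \<open>s = k / (d - k)\<close> of
  \<open>(1 + s) ^ d / s ^ k\<close>. In the extreme cases it escapes to \<open>0\<close> or to
  infinity and is replaced by a limit.\<close>

lemma binomial_capacity: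
  fixes I B :: real
  assumes "k \<le> d" and le: "\<And>s. s > 0 \<Longrightarrow> I * s ^ k \<le> B * (1 + s) ^ d"
  shows "(real k / real d) ^ k * ((real d - real k) / real d) ^ (d - k) * I \<le> B"
proof -
  have lim: "((\<lambda>s. B * (1 + s) ^ d) \<longlongrightarrow> B) (at_right (0::real))"
    by (auto intro!: tendsto_eq_intros)
  consider "k = 0" | "k = d" "k > 0" | "0 < k" "k < d"
    using assms(1) by linarith
  then show ?thesis
  proof cases
    case 1
    have "I \<le> B"
      by (rule tendsto_lowerbound[OF lim])
         (use le in \<open>auto simp: 1 intro!: eventually_at_right_less[THEN eventually_mono]\<close>)
    then show ?thesis using 1 by (cases "d = 0") auto
  next
    case 2
    \<comment> \<open>The substitution \<open>s = 1 / u\<close> moves the limit at infinity to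
      \<open>0\<close>.\<close>
    have "I \<le> B * (1 + u) ^ d" if "u > 0" for u
    proof -
      have "I * (1 / u) ^ d * u ^ d \<le> B * (1 + 1 / u) ^ d * u ^ d"
        using le[of "1 / u"] that 2 by (intro mult_right_mono) auto
      then have "I * (1 / u * u) ^ d \<le> B * ((1 + 1 / u) * u) ^ d"
        by (simp only: power_mult_distrib mult.assoc)
      also have "(1 + 1 / u) * u = 1 + u"
        using that by (simp add: field_simps)
      finally show ?thesis
        using that by simp
    qed
    then have "I \<le> B"
      by (intro tendsto_lowerbound[OF lim])
         (auto intro!: eventually_at_right_less[THEN eventually_mono])
    then show ?thesis using 2 by simp
  next
    case 3
    define a where "a = real k"
    define c where "c = real d - real k"
    have ac: "a > 0" "c > 0" "real d = a + c" "real d - real k = c"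
      using 3 by (simp_all add: a_def c_def)
    \<comment> \<open>The factor \<open>X\<close> normalizes \<open>(1 + a / c) ^ d\<close> to
      \<open>1\<close>.\<close>
    define X where "X = (c / (a + c)) ^ d"
    have "X * (I * (a / c) ^ k) \<le> X * (B * (1 + a / c) ^ d)"
      using le[of "a / c"] ac by (intro mult_left_mono) (auto simp: X_def)
    also have "\<dots> = B * ((c / (a + c)) * (1 + a / c)) ^ d"
      by (simp only: X_def power_mult_distrib mult_ac)
    also have "(c / (a + c)) * (1 + a / c) = 1"
      using ac by (simp add: divide_simps)
    also have "X * (I * (a / c) ^ k) = (c / (a + c)) ^ (d - k) * ((c / (a + c)) ^ k * (a / c) ^ k) * I"
      unfolding X_def using 3 by (simp add: mult_ac flip: power_add)
    also have "(c / (a + c)) ^ k * (a / c) ^ k = (a / (a + c)) ^ k"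
      unfolding power_mult_distrib[symmetric] using ac by simp
    finally show ?thesis
      unfolding ac(4) ac(3) by (simp add: a_def mult_ac)
  qed
qed

text \<open>For \<open>k \<le> d\<close> this is the coefficient of \<open>s ^ k\<close> in
  \<open>(1 + s) ^ d\<close> divided by the infimum of \<open>(1 + s) ^ d / s ^ k\<close> over
  \<open>s > 0\<close>; binomial powers are thus the extremal case of the bounds below.\<close>

definition capacity_factor :: "nat \<Rightarrow> nat \<Rightarrow> real" where
  "capacity_factor d k = real (d choose k) * (real k / real d) ^ k
     * ((real d - real k) / real d) ^ (d - k)"

lemma capacity_factor_nonneg: "capacity_factor d k \<ge> 0"
  by (cases "k \<le> d") (auto simp: capacity_factor_def)

text \<open>After rescaling the variable by \<open>\<rho>\<close>, log-concavity bounds all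
  normalized coefficients by the \<open>k\<close>-th one. The polynomial is then dominated by a
  multiple of \<open>(1 + s) ^ d\<close>, to which \<open>binomial_capacity\<close> applies.\<close>

lemma coeff_linear_product_pos_ge:
  assumes "\<forall>c\<in>set l. fst c > 0 \<and> snd c > 0"
    and le: "\<And>t. t > 0 \<Longrightarrow> I * t ^ k \<le> poly (linear_product l) t"
  shows "capacity_factor (length l) k * I \<le> coeff (linear_product l) k"
proof (cases "k \<le> length l")
  case True
  define d where "d = length l"
  define b where "b = normalized_coeff d (linear_product l)"
  have coeff: "coeff (linear_product l) j = real (d choose j) * b j" if "j \<le> d" for j
    using that by (simp add: b_def normalized_coeff_def)
  have pos: "b j > 0" if "j \<le> d" for j
    using coeff_linear_product_pos[OF assms(1)] that by (simp add: b_def normalized_coeff_def d_def)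
  obtain \<rho> where \<rho>: "\<rho> > 0" "\<And>j. j \<le> d \<Longrightarrow> b j * \<rho> ^ k \<le> b k * \<rho> ^ j"
    by (rule log_concave_le_geometric[of d b k])
       (use pos newton_inequality[OF assms(1)] True in \<open>auto simp: b_def d_def\<close>)
  have "I * s ^ k \<le> b k * (1 + s) ^ d" if "s > 0" for s
  proof -
    have "I * s ^ k = \<rho> ^ k * (I * (s / \<rho>) ^ k)"
      using \<rho>(1) by (simp add: power_divide)
    also have "\<dots> \<le> \<rho> ^ k * poly (linear_product l) (s / \<rho>)"
      using le[of "s / \<rho>"] \<rho>(1) that by (intro mult_left_mono) auto
    also have "poly (linear_product l) (s / \<rho>) = (\<Sum>j\<le>d. coeff (linear_product l) j * (s / \<rho>) ^ j)"
      unfolding poly_altdef using degree_linear_product[of l]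
      by (intro sum.mono_neutral_left) (auto simp: coeff_eq_0 d_def)
    also have "\<rho> ^ k * \<dots> = (\<Sum>j\<le>d. real (d choose j) * (s / \<rho>) ^ j * (b j * \<rho> ^ k))"
      unfolding sum_distrib_left by (intro sum.cong) (auto simp: coeff)
    also have "\<dots> \<le> (\<Sum>j\<le>d. real (d choose j) * (s / \<rho>) ^ j * (b k * \<rho> ^ j))"
      using \<rho> that by (intro sum_mono mult_left_mono) auto
    also have "\<dots> = b k * (\<Sum>j\<le>d. real (d choose j) * s ^ j)"
      unfolding sum_distrib_left using \<rho>(1) by (intro sum.cong) (auto simp: power_divide)
    also have "(\<Sum>j\<le>d. real (d choose j) * s ^ j) = (1 + s) ^ d"
      using binomial_ring[of s 1 d] by (simp add: add.commute)
    finally show ?thesis .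
  qed
  then have "(real k / real d) ^ k * ((real d - real k) / real d) ^ (d - k) * I \<le> b k"
    using True by (intro binomial_capacity) (auto simp: d_def)
  then have "real (d choose k) * ((real k / real d) ^ k * ((real d - real k) / real d) ^ (d - k) * I)
      \<le> real (d choose k) * b k"
    by (rule mult_left_mono) simp
  then show ?thesis
    using True coeff[of k] by (simp add: capacity_factor_def d_def mult_ac)
next
  case False
  then show ?thesis
    using degree_linear_product[of l] by (simp add: capacity_factor_def coeff_eq_0 binomial_eq_0)
qed

text \<open>Adding \<open>\<epsilon>\<close> to all entries makes them positive and only increases
  the values at positive \<open>t\<close>, so the capacity hypothesis persists. The coefficient is
  recovered as \<open>\<epsilon>\<close> tends to \<open>0\<close>.\<close>

lemma coeff_linear_product_ge:
  assumes nonneg: "\<forall>c\<in>set l. fst c \<ge> 0 \<and> snd c \<ge> 0"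
    and le: "\<And>t. t > 0 \<Longrightarrow> I * t ^ k \<le> poly (linear_product l) t"
  shows "capacity_factor (length l) k * I \<le> coeff (linear_product l) k"
proof -
  define L where "L \<epsilon> = map (\<lambda>c. (fst c + \<epsilon>, snd c + \<epsilon>)) l" for \<epsilon> :: real
  have lim: "((\<lambda>\<epsilon>. coeff (linear_product (map (\<lambda>c. (fst c + \<epsilon>, snd c + \<epsilon>)) l)) j)
      \<longlongrightarrow> coeff (linear_product l) j) (at_right 0)" for j
  proof (induction l arbitrary: j)
    case (Cons c l)
    show ?case
    proof (cases j)
      case 0
      then show ?thesis
        by (auto simp: linear_product_Cons intro!: tendsto_eq_intros Cons)
    next
      case (Suc i)
      then show ?thesis
        by (auto simp: linear_product_Cons intro!: tendsto_eq_intros Cons)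
    qed
  qed (simp add: linear_product_Nil)
  have mono: "0 \<le> poly (linear_product l) t \<and> poly (linear_product l) t \<le> poly (linear_product (L \<epsilon>)) t"
    if "t > 0" "\<epsilon> > 0" for t \<epsilon>
    using nonneg unfolding L_def
  proof (induction l)
    case (Cons c l)
    have *: "poly (linear_product (c # l)) t = (fst c + t * snd c) * poly (linear_product l) t" for c l
      by (simp add: linear_product_Cons algebra_simps)
    from Cons that show ?case
      by (auto simp: * intro!: mult_mono add_mono)
  qed (simp add: linear_product_Nil)
  show ?thesis
  proof (rule tendsto_lowerbound[OF lim])
    show "\<forall>\<^sub>F \<epsilon> in at_right 0. capacity_factor (length l) k * I
        \<le> coeff (linear_product (map (\<lambda>c. (fst c + \<epsilon>, snd c + \<epsilon>)) l)) k"
    proof (rule eventually_at_right_less[THEN eventually_mono])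
      fix \<epsilon> :: real assume \<epsilon>: "0 < \<epsilon>"
      have "capacity_factor (length (L \<epsilon>)) k * I \<le> coeff (linear_product (L \<epsilon>)) k"
      proof (rule coeff_linear_product_pos_ge)
        show "\<forall>c\<in>set (L \<epsilon>). fst c > 0 \<and> snd c > 0"
          using nonneg \<epsilon> by (force simp: L_def)
        show "I * t ^ k \<le> poly (linear_product (L \<epsilon>)) t" if "t > 0" for t
          using le[OF that] mono[OF that \<epsilon>] by linarith
      qed
      then show "capacity_factor (length l) k * I
        \<le> coeff (linear_product (map (\<lambda>c. (fst c + \<epsilon>, snd c + \<epsilon>)) l)) k"
        by (simp add: L_def)
    qed
  qed simp
qed

section \<open>From products of linear factors to real-rooted polynomials\<close>

lemma map_poly_of_real_mult:
  "map_poly complex_of_real (p * q) = map_poly of_real p * map_poly of_real q"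
  by (intro poly_eqI) (simp add: coeff_map_poly coeff_mult)

lemma poly_map_poly_of_real:
  "poly (map_poly complex_of_real p) (of_real x) = of_real (poly p x)"
  by (induction p) (simp_all add: map_poly_pCons)

lemma real_rooted_factorization:
  fixes p :: "real poly"
  assumes "\<And>z. poly (map_poly complex_of_real p) z = 0 \<Longrightarrow> z \<in> \<real>\<^sub>\<le>\<^sub>0"
  obtains l c where "p = smult c (linear_product l)" "length l = degree p"
    "\<forall>c\<in>set l. fst c \<ge> 0 \<and> snd c \<ge> 0"
  using assms
proof (induction "degree p" arbitrary: p thesis)
  case 0
  from 0(1)[symmetric] obtain c where "p = [:c:]"
    by (metis degree_eq_zeroE)
  then show ?case
    using 0(2)[of c "[]"] by (simp add: linear_product_Nil)
next
  case (Suc n)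
  have "\<not> constant (poly (map_poly complex_of_real p))"
    using Suc.hyps(2) by (simp add: constant_degree degree_map_poly)
  then obtain z where z: "poly (map_poly complex_of_real p) z = 0"
    using fundamental_theorem_of_algebra by blast
  then obtain a where a: "z = of_real a" "a \<le> 0"
    using Suc.prems(2)[OF z] by (auto elim: nonpos_Reals_cases)
  have "poly p a = 0"
    using z by (simp add: a(1) poly_map_poly_of_real)
  then obtain q where q: "p = [:- a, 1:] * q"
    by (auto simp: poly_eq_0_iff_dvd elim: dvdE)
  with Suc.hyps(2) have deg: "degree p = Suc (degree q)"
    by (subst q, subst degree_mult_eq) auto
  have "z \<in> \<real>\<^sub>\<le>\<^sub>0" if "poly (map_poly complex_of_real q) z = 0" for z
    using Suc.prems(2)[of z] that unfolding q map_poly_of_real_mult by simp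
  then obtain l c where l: "q = smult c (linear_product l)" "length l = degree q"
    "\<forall>c\<in>set l. fst c \<ge> 0 \<and> snd c \<ge> 0"
    using Suc.hyps(1)[of q] Suc.hyps(2) deg by auto
  show ?case
    by (rule Suc.prems(1)[of c "(- a, 1) # l"])
       (use l a deg q in \<open>auto simp: linear_product_Cons\<close>)
qed

lemma real_rooted_coeff_ge:
  fixes p :: "real poly"
  assumes "\<And>z. poly (map_poly complex_of_real p) z = 0 \<Longrightarrow> z \<in> \<real>\<^sub>\<le>\<^sub>0"
    and nonneg: "\<And>j. coeff p j \<ge> 0" and deg: "degree p \<le> d"
    and le: "\<And>t. t > 0 \<Longrightarrow> I * t ^ k \<le> poly p t"
  shows "capacity_factor d k * I \<le> coeff p k"
proof -
  obtain l c where l: "p = smult c (linear_product l)" "length l = degree p"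
    "\<forall>c\<in>set l. fst c \<ge> 0 \<and> snd c \<ge> 0"
    using real_rooted_factorization[of p thesis] assms(1) by blast
  \<comment> \<open>Constant factors \<open>1\<close> pad the list to length \<open>d\<close>, since
    the factor to be reached is that of \<open>d\<close> and not of the actual degree.\<close>
  define l' where "l' = replicate (d - degree p) (1, 0) @ l"
  have "linear_product (replicate n (1, 0) @ l) = linear_product l" for n
    by (induction n) (simp_all add: linear_product_Cons)
  then have l': "linear_product l' = linear_product l" "length l' = d"
    "\<forall>c\<in>set l'. fst c \<ge> 0 \<and> snd c \<ge> 0"
    using l(2,3) deg by (auto simp: l'_def)
  \<comment> \<open>The value at \<open>1\<close> is positive, as \<open>1\<close> is not a
    non-positive real; this fixes the sign of the leading scalar \<open>c\<close>.\<close>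
  have "poly p 1 \<ge> 0"
    using nonneg by (simp add: poly_altdef sum_nonneg)
  moreover have "poly p 1 \<noteq> 0"
    using assms(1)[of 1] poly_map_poly_of_real[of p 1] by auto
  ultimately have "c * poly (linear_product l) 1 > 0"
    unfolding l(1) by (metis poly_smult less_le)
  moreover have "poly (linear_product l) 1 \<ge> 0"
    using l(3) by (induction l) (auto simp: linear_product_Nil linear_product_Cons)
  ultimately have "c > 0"
    by (simp add: zero_less_mult_iff)
  have "capacity_factor (length l') k * (I / c) \<le> coeff (linear_product l') k"
    using l'(3)
  proof (rule coeff_linear_product_ge)
    show "I / c * t ^ k \<le> poly (linear_product l') t" if "t > 0" for t
      using le[OF that] \<open>c > 0\<close> by (simp add: l(1) l'(1) pos_divide_le_eq mult.commute)
  qed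
  then show ?thesis
    using \<open>c > 0\<close> by (simp add: l(1) l' pos_divide_le_eq mult.commute)
qed

subsection \<open>Stable generating functions\<close>

text \<open>A polynomial is encoded by an indexed family of exponent vectors, so extracting a
  coefficient amounts to filtering the index set. The general value type admits real, complex and
  polynomial arguments.\<close>

definition monomial_sum ::
    "'i set \<Rightarrow> ('i \<Rightarrow> 'v \<Rightarrow> nat) \<Rightarrow> 'v set \<Rightarrow> ('v \<Rightarrow> 'a::comm_semiring_1) \<Rightarrow> 'a" where
  "monomial_sum A m W z = (\<Sum>i\<in>A. \<Prod>v\<in>W. z v ^ m i v)"

lemma monomial_sum_nonneg:
  fixes x :: "'v \<Rightarrow> real"
  shows "(\<And>v. v \<in> W \<Longrightarrow> x v \<ge> 0) \<Longrightarrow> monomial_sum A m W x \<ge> 0"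
  by (auto simp: monomial_sum_def intro!: sum_nonneg prod_nonneg)

lemma monomial_sum_one: "monomial_sum A m W (\<lambda>_. 1) = of_nat (card A)"
  by (simp add: monomial_sum_def)

lemma of_real_monomial_sum:
  "of_real (monomial_sum A m W x) = monomial_sum A m W (\<lambda>v. of_real (x v))"
  by (simp add: monomial_sum_def)

lemma poly_monomial_sum:
  "poly (monomial_sum A m W p) w = monomial_sum A m W (\<lambda>v. poly (p v) w)"
  by (simp add: monomial_sum_def poly_sum poly_prod)

lemma monomial_sum_scale:
  assumes "\<And>i. i \<in> A \<Longrightarrow> (\<Sum>v\<in>W. m i v) = N"
  shows "monomial_sum A m W (\<lambda>v. c * z v) = c ^ N * monomial_sum A m W z"
  unfolding monomial_sum_def sum_distrib_left
  by (intro sum.cong) (simp_all add: power_mult_distrib prod.distrib assms flip: power_sum)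

lemma monomial_sum_fun_upd:
  assumes "finite A" "finite W" "v \<in> W" "\<And>i. i \<in> A \<Longrightarrow> m i v \<le> d"
  shows "monomial_sum A m W (z(v := t)) =
    (\<Sum>k\<le>d. monomial_sum {i \<in> A. m i v = k} m (W - {v}) z * t ^ k)"
proof -
  have "monomial_sum A m W (z(v := t)) = (\<Sum>i\<in>A. (\<Prod>u\<in>W - {v}. z u ^ m i u) * t ^ m i v)"
    unfolding monomial_sum_def
  proof (intro sum.cong refl)
    fix i
    have "(\<Prod>u\<in>W. (z(v := t)) u ^ m i u) = t ^ m i v * (\<Prod>u\<in>W - {v}. (z(v := t)) u ^ m i u)"
      using assms(2,3) by (simp add: prod.remove)
    also have "(\<Prod>u\<in>W - {v}. (z(v := t)) u ^ m i u) = (\<Prod>u\<in>W - {v}. z u ^ m i u)"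
      by (intro prod.cong) auto
    finally show "(\<Prod>u\<in>W. (z(v := t)) u ^ m i u) = (\<Prod>u\<in>W - {v}. z u ^ m i u) * t ^ m i v"
      by (simp add: mult.commute)
  qed
  also have "\<dots> = (\<Sum>k\<le>d. \<Sum>i\<in>{i \<in> A. m i v = k}. (\<Prod>u\<in>W - {v}. z u ^ m i u) * t ^ m i v)"
    using assms by (intro sum.group[symmetric]) auto
  also have "\<dots> = (\<Sum>k\<le>d. monomial_sum {i \<in> A. m i v = k} m (W - {v}) z * t ^ k)"
    unfolding monomial_sum_def sum_distrib_right by (intro sum.cong) auto
  finally show ?thesis .
qed

text \<open>The zero polynomial does not count as stable, so stability of a coefficient requires a
  nonempty index set.\<close>

definition half_plane_stable :: "'i set \<Rightarrow> ('i \<Rightarrow> 'v \<Rightarrow> nat) \<Rightarrow> 'v set \<Rightarrow> bool" where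
  "half_plane_stable A m W \<longleftrightarrow>
     (\<forall>z. (\<forall>v\<in>W. Re (z v) > 0) \<longrightarrow> monomial_sum A m W z \<noteq> 0)"

text \<open>
  The coefficient is restricted to the complex line through \<open>z\<close> and the all-ones point, where its
  value is a positive count.
\<close>

lemma half_plane_stable_coeff:
  assumes "finite A" "finite W" "v \<in> W" "half_plane_stable A m W"
    and ne: "{i \<in> A. m i v = k} \<noteq> {}"
  shows "half_plane_stable {i \<in> A. m i v = k} m (W - {v})"
  unfolding half_plane_stable_def
proof (intro allI impI)
  fix z :: "'b \<Rightarrow> complex" assume z: "\<forall>u\<in>W - {v}. Re (z u) > 0"
  \<comment> \<open>The line passes through \<open>z u\<close> at \<open>w = 0\<close> and through
    \<open>1\<close> at \<open>w = 1\<close>.\<close>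
  define p where "p u = [:z u, 1 - z u:]" for u
  define a where "a j = monomial_sum {i \<in> A. m i v = j} m (W - {v}) p" for j
  define d where "d = (MAX i\<in>A. m i v)"
  have d: "m i v \<le> d" if "i \<in> A" for i
    using assms(1) that by (simp add: d_def)
  have "\<forall>u\<in>W - {v}. eventually (\<lambda>w. Re (poly (p u) w) > 0) (nhds 0)"
  proof
    fix u assume u: "u \<in> W - {v}"
    have "((\<lambda>w. Re (poly (p u) w)) \<longlongrightarrow> Re (z u)) (nhds 0)"
      unfolding p_def by (auto intro!: tendsto_eq_intros filterlim_ident)
    then show "eventually (\<lambda>w. Re (poly (p u) w) > 0) (nhds 0)"
      using z u by (auto dest: order_tendstoD(1))
  qed
  then have "eventually (\<lambda>w. \<forall>u\<in>W - {v}. Re (poly (p u) w) > 0) (nhds 0)"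
    using assms(2) by (simp add: eventually_ball_finite)
  then obtain \<delta> where \<delta>: "\<delta> > 0" "\<And>w u. norm w < \<delta> \<Longrightarrow> u \<in> W - {v} \<Longrightarrow> Re (poly (p u) w) > 0"
    unfolding eventually_nhds_metric by auto
  have "poly (a k) 0 \<noteq> 0"
  proof (rule coeff_nonzero_if_half_plane_stable[OF \<delta>(1)])
    show "k \<le> d" using ne d by auto
    have "poly (a k) 1 = of_nat (card {i \<in> A. m i v = k})"
      by (simp add: a_def p_def poly_monomial_sum monomial_sum_one)
    then show "a k \<noteq> 0"
      using ne assms(1) by auto
    fix w t :: complex assume w: "norm w < \<delta>" and t: "Re t > 0"
    have "(\<Sum>j\<le>d. poly (a j) w * t ^ j) = monomial_sum A m W ((\<lambda>u. poly (p u) w)(v := t))"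
      by (simp add: monomial_sum_fun_upd[of A W v m d, OF assms(1-3) d] a_def poly_monomial_sum)
    also have "\<dots> \<noteq> 0"
      using assms(4) \<delta>(2)[OF w] t unfolding half_plane_stable_def by auto
    finally show "(\<Sum>j\<le>d. poly (a j) w * t ^ j) \<noteq> 0" .
  qed
  then show "monomial_sum {i \<in> A. m i v = k} m (W - {v}) z \<noteq> 0"
    by (simp add: a_def p_def poly_monomial_sum)
qed

lemma Re_csqrt_pos: "z \<notin> \<real>\<^sub>\<le>\<^sub>0 \<Longrightarrow> Re (csqrt z) > 0"
proof (rule ccontr)
  assume z: "z \<notin> \<real>\<^sub>\<le>\<^sub>0" and "\<not> Re (csqrt z) > 0"
  define y where "y = Im (csqrt z)"
  have "csqrt z = \<i> * of_real y"
    using \<open>\<not> Re (csqrt z) > 0\<close> csqrt_principal[of z] by (auto simp: complex_eq_iff y_def)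
  then have "(csqrt z)\<^sup>2 = of_real (- (y\<^sup>2))"
    by (simp add: power_mult_distrib)
  then have "z = of_real (- (y\<^sup>2))"
    by simp
  with z show False
    by (simp only: nonpos_Reals_of_real_iff) simp
qed

text \<open>With the other variables fixed at positive values, a root \<open>t\<close> off the
  non-positive real axis would share an open half-plane through \<open>0\<close> with them. By
  homogeneity the half-plane can be rotated to the right one, against stability; so
  \<open>real_rooted_coeff_ge\<close> applies.\<close>

lemma monomial_sum_coeff_ge:
  fixes x :: "'v \<Rightarrow> real"
  assumes "finite A" "finite W" "v \<in> W" "half_plane_stable A m W"
    and hom: "\<And>i. i \<in> A \<Longrightarrow> (\<Sum>u\<in>W. m i u) = N"
    and d: "\<And>i. i \<in> A \<Longrightarrow> m i v \<le> d"
    and x: "\<And>u. u \<in> W - {v} \<Longrightarrow> x u > 0"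
    and le: "\<And>t. t > 0 \<Longrightarrow> I * t ^ k \<le> monomial_sum A m W (x(v := t))"
  shows "capacity_factor d k * I \<le> monomial_sum {i \<in> A. m i v = k} m (W - {v}) x"
proof -
  note upd = monomial_sum_fun_upd[of A W v m d, OF assms(1-3) d]
  define c where "c j = monomial_sum {i \<in> A. m i v = j} m (W - {v}) x" for j
  define p where "p = (\<Sum>j\<le>d. monom (c j) j)"
  have c_nonneg: "c j \<ge> 0" for j
    unfolding c_def using x by (intro monomial_sum_nonneg) (auto intro: less_imp_le)
  have coeff_p: "coeff p j = (if j \<le> d then c j else 0)" for j
    by (auto simp: p_def coeff_sum)
  have "c j = 0" if "j > d" for j
  proof -
    have "{i \<in> A. m i v = j} = {}" using d that by force
    then show ?thesis by (simp only: c_def monomial_sum_def sum.empty)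
  qed
  then have coeff_p': "coeff p j = c j" for j
    by (simp add: coeff_p)
  have poly_p: "poly p t = monomial_sum A m W (x(v := t))" for t
    by (simp add: upd p_def poly_sum poly_monom c_def)
  have "map_poly complex_of_real p = (\<Sum>j\<le>d. monom (of_real (c j)) j)"
    by (intro poly_eqI) (simp add: coeff_map_poly coeff_p coeff_sum)
  then have poly_p': "poly (map_poly complex_of_real p) t
      = monomial_sum A m W ((\<lambda>u. of_real (x u))(v := t))" for t
    by (simp add: upd poly_sum poly_monom c_def of_real_monomial_sum)
  have "capacity_factor d k * I \<le> coeff p k"
  proof (rule real_rooted_coeff_ge)
    show "degree p \<le> d"
      unfolding p_def by (intro degree_sum_le) (auto intro: order_trans[OF degree_monom_le])
    show "coeff p j \<ge> 0" for j
      by (simp add: coeff_p' c_nonneg)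
    show "I * t ^ k \<le> poly p t" if "t > 0" for t
      using le[OF that] by (simp add: poly_p)
    fix t assume root: "poly (map_poly complex_of_real p) t = 0"
    show "t \<in> \<real>\<^sub>\<le>\<^sub>0"
    proof (rule ccontr)
      assume t: "t \<notin> \<real>\<^sub>\<le>\<^sub>0"
      \<comment> \<open>Multiplying by \<open>cnj s\<close> rotates \<open>t\<close> and the positive reals into the right half-plane.\<close>
      define s where "s = csqrt t"
      have s: "Re s > 0" "t = s * s"
        using Re_csqrt_pos[OF t] power2_csqrt[of t] by (simp_all add: s_def power2_eq_square)
      define z where "z = (\<lambda>u. complex_of_real (x u))(v := t)"
      have "Re (cnj s * z u) > 0" if "u \<in> W" for u
      proof (cases "u = v")
        case True
        have "cnj s * t = of_real ((norm s)\<^sup>2) * s"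
          unfolding s(2) complex_norm_square by (simp only: mult_ac)
        moreover have "Re (of_real ((norm s)\<^sup>2) * s) > 0"
          using s(1) by (cases "s = 0") simp_all
        ultimately show ?thesis by (simp only: True z_def fun_upd_same)
      next
        case False
        then show ?thesis using s(1) x[of u] that by (simp add: z_def)
      qed
      then have "monomial_sum A m W (\<lambda>u. cnj s * z u) \<noteq> 0"
        using assms(4) by (simp add: half_plane_stable_def)
      then have "monomial_sum A m W z \<noteq> 0"
        using monomial_sum_scale[where A = A and m = m and W = W and N = N and c = "cnj s" and z = z, OF hom]
        by auto
      then show False
        using root by (simp only: poly_p' z_def)
    qed
  qed
  then show ?thesis by (simp add: coeff_p' c_def)
qed

subsection \<open>Orientations\<close>

context finite_graph
begin

lemma finite_ends: "e \<in> E \<Longrightarrow> finite (ends e)"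
  using card_ends[of e] by (intro card_ge_0_finite) simp

text \<open>Without loops the head determines the direction, so choosing an endpoint of an edge is
  choosing its direction.\<close>

lemma bij_betw_head:
  assumes "e \<in> E"
  shows "bij_betw snd {(u, v). ends e = {u, v}} (ends e)"
proof -
  obtain a b where ab: "ends e = {a, b}" "a \<noteq> b"
    using card_ends[OF assms] by (auto simp: card_2_iff)
  then have "{(u, v). ends e = {u, v}} = {(a, b), (b, a)}"
    by (auto simp: doubleton_eq_iff)
  with ab show ?thesis
    by (auto simp: bij_betw_def)
qed

lemma finite_directions: "e \<in> E \<Longrightarrow> finite {(u, v). ends e = {u, v}}"
  using bij_betw_finite[OF bij_betw_head] finite_ends by blast

lemma finite_orientations: "finite (orientations E ends)"
  unfolding orientations_def by (intro finite_PiE finite_edges finite_directions)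

lemma head_in_verts:
  assumes "ori \<in> orientations E ends" "e \<in> E"
  shows "snd (ori e) \<in> ends e" "snd (ori e) \<in> V"
proof -
  have "ori e \<in> {(u, v). ends e = {u, v}}"
    using assms unfolding orientations_def by (rule PiE_mem)
  then show "snd (ori e) \<in> ends e"
    by (cases "ori e") simp
  with ends_subset[OF assms(2)] show "snd (ori e) \<in> V"
    by (rule subsetD)
qed

lemma indegree_le_degree:
  assumes "ori \<in> orientations E ends"
  shows "indegree E ori v \<le> vertex_degree E ends v"
  unfolding indegree_def vertex_degree_def
  by (intro card_mono) (use finite_edges head_in_verts(1)[OF assms] in auto)

lemma sum_indegree:
  assumes "ori \<in> orientations E ends"
  shows "(\<Sum>v\<in>V. indegree E ori v) = card E"
proof -
  have "(\<Sum>v\<in>V. \<Sum>e\<in>{e \<in> E. snd (ori e) = v}. 1) = (\<Sum>e\<in>E. 1::nat)"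
    by (intro sum.group finite_edges finite_verts) (use head_in_verts(2)[OF assms] in auto)
  then show ?thesis by (simp add: indegree_def)
qed

text \<open>Expanding the product picks a head for every edge; grouping the edges by head gives the
  in-degrees as exponents.\<close>

lemma prod_edges_eq_monomial_sum:
  "(\<Prod>e\<in>E. \<Sum>u\<in>ends e. z u) = monomial_sum (orientations E ends) (indegree E) V z"
proof -
  have "(\<Prod>e\<in>E. \<Sum>u\<in>ends e. z u) = (\<Prod>e\<in>E. \<Sum>d\<in>{(u, v). ends e = {u, v}}. z (snd d))"
    by (intro prod.cong refl sum.reindex_bij_betw[symmetric] bij_betw_head)
  also have "\<dots> = (\<Sum>ori\<in>orientations E ends. \<Prod>e\<in>E. z (snd (ori e)))"
    unfolding orientations_def by (intro prod_sum_PiE finite_edges) (simp add: finite_directions)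
  also have "\<dots> = (\<Sum>ori\<in>orientations E ends. \<Prod>v\<in>V. z v ^ indegree E ori v)"
  proof (intro sum.cong refl)
    fix ori assume ori: "ori \<in> orientations E ends"
    have "(\<Prod>e\<in>E. z (snd (ori e))) = (\<Prod>v\<in>V. \<Prod>e\<in>{e \<in> E. snd (ori e) = v}. z (snd (ori e)))"
      by (intro prod.group[symmetric] finite_edges finite_verts)
         (use head_in_verts(2)[OF ori] in auto)
    then show "(\<Prod>e\<in>E. z (snd (ori e))) = (\<Prod>v\<in>V. z v ^ indegree E ori v)"
      by (simp add: indegree_def)
  qed
  finally show ?thesis by (simp add: monomial_sum_def)
qed

section \<open>Prescribing the in-degrees one vertex at a time\<close>

definition partial_orientations :: "('v \<Rightarrow> nat) \<Rightarrow> 'v set \<Rightarrow> ('e \<Rightarrow> 'v \<times> 'v) set" where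
  "partial_orientations r S = {ori \<in> orientations E ends. \<forall>v\<in>S. indegree E ori v = r v}"

lemma finite_partial_orientations: "finite (partial_orientations r S)"
  unfolding partial_orientations_def using finite_orientations by simp

lemma partial_orientations_insert:
  "partial_orientations r (insert v S)
     = {ori \<in> partial_orientations r S. indegree E ori v = r v}"
  by (auto simp: partial_orientations_def)

text \<open>For empty \<open>S\<close> every edge factor has positive real part; each further vertex
  extracts a coefficient, which \<open>half_plane_stable_coeff\<close> handles.\<close>

lemma partial_orientations_stable:
  assumes "S \<subseteq> V" "partial_orientations r S \<noteq> {}"
  shows "half_plane_stable (partial_orientations r S) (indegree E) (V - S)"
  using finite_subset[OF assms(1) finite_verts] assms
proof (induction S rule: finite_induct)
  case empty
  have "(\<Prod>e\<in>E. \<Sum>u\<in>ends e. z u) \<noteq> 0" if z: "\<forall>v\<in>V. Re (z v) > 0" for z :: "'v \<Rightarrow> complex"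
  proof -
    have pos: "Re (\<Sum>u\<in>ends e. z u) > 0" if "e \<in> E" for e
      unfolding Re_sum using finite_ends[OF that] card_ends[OF that] ends_subset[OF that] z
      by (intro sum_pos) auto
    then show ?thesis
      unfolding prod_zero_iff[OF finite_edges] by (metis less_irrefl zero_complex.sel(1))
  qed
  then show ?case
    by (simp add: half_plane_stable_def partial_orientations_def prod_edges_eq_monomial_sum)
next
  case (insert v S)
  have "partial_orientations r S \<noteq> {}"
    using insert.prems(2) by (auto simp: partial_orientations_insert)
  with insert have "half_plane_stable (partial_orientations r S) (indegree E) (V - S)"
    by auto
  moreover have "V - insert v S = V - S - {v}"
    by auto
  ultimately show ?case
    using insert finite_verts finite_partial_orientations unfolding partial_orientations_insert
    by (simp add: half_plane_stable_coeff)
qed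

text \<open>Gurvits' induction: the bound for \<open>S\<close>, used with a free value
  \<open>t\<close> at the new vertex \<open>v\<close>, is the capacity hypothesis for extracting the
  power \<open>r v\<close> of that variable.\<close>

lemma partial_orientations_ge:
  fixes x :: "'v \<Rightarrow> real" and I :: real
  assumes base: "\<And>x. \<forall>v\<in>V. x v > 0 \<Longrightarrow> I * (\<Prod>v\<in>V. x v ^ r v) \<le> (\<Prod>e\<in>E. \<Sum>u\<in>ends e. x u)"
    and "S \<subseteq> V" "\<forall>v\<in>V - S. x v > 0"
  shows "(\<Prod>v\<in>S. capacity_factor (vertex_degree E ends v) (r v)) * (I * (\<Prod>v\<in>V - S. x v ^ r v))
     \<le> monomial_sum (partial_orientations r S) (indegree E) (V - S) x"
  using finite_subset[OF assms(2) finite_verts] assms(2,3)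
proof (induction S arbitrary: x rule: finite_induct)
  case empty
  then show ?case
    using base by (simp add: partial_orientations_def prod_edges_eq_monomial_sum)
next
  case (insert v S)
  define C where "C = (\<Prod>v\<in>S. capacity_factor (vertex_degree E ends v) (r v))"
  define J where "J = C * (I * (\<Prod>u\<in>V - S - {v}. x u ^ r u))"
  have Diff: "V - insert v S = V - S - {v}"
    by auto
  have v: "v \<in> V - S"
    using insert by auto
  have le: "J * t ^ r v \<le> monomial_sum (partial_orientations r S) (indegree E) (V - S) (x(v := t))"
    if "t > 0" for t
  proof -
    have IH: "C * (I * (\<Prod>u\<in>V - S. (x(v := t)) u ^ r u))
        \<le> monomial_sum (partial_orientations r S) (indegree E) (V - S) (x(v := t))"
      unfolding C_def using insert.prems that by (intro insert.IH) auto
    have "(\<Prod>u\<in>V - S. (x(v := t)) u ^ r u) = t ^ r v * (\<Prod>u\<in>V - S - {v}. (x(v := t)) u ^ r u)"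
      using v finite_verts by (simp add: prod.remove)
    also have "(\<Prod>u\<in>V - S - {v}. (x(v := t)) u ^ r u) = (\<Prod>u\<in>V - S - {v}. x u ^ r u)"
      by (intro prod.cong) auto
    finally have "J * t ^ r v = C * (I * (\<Prod>u\<in>V - S. (x(v := t)) u ^ r u))"
      by (simp only: J_def mult_ac)
    with IH show ?thesis by simp
  qed
  have "capacity_factor (vertex_degree E ends v) (r v) * J
    \<le> monomial_sum (partial_orientations r (insert v S)) (indegree E) (V - insert v S) x"
  proof (cases "partial_orientations r S = {}")
    case True
    \<comment> \<open>Stability fails here, but the sum is \<open>0\<close>, which makes the claim a
      matter of signs.\<close>
    then have "J \<le> 0"
      using le[of 1] by (simp add: monomial_sum_def)
    with True show ?thesis
      by (simp add: partial_orientations_insert monomial_sum_def capacity_factor_nonneg mult_nonneg_nonpos)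
  next
    case False
    \<comment> \<open>The in-degrees on \<open>S\<close> are prescribed and all in-degrees add up to
      \<open>card E\<close>, so the remaining polynomial is homogeneous.\<close>
    have hom: "(\<Sum>u\<in>V - S. indegree E ori u) = card E - (\<Sum>u\<in>S. r u)"
      if "ori \<in> partial_orientations r S" for ori
    proof -
      have "(\<Sum>u\<in>V - S. indegree E ori u) = card E - (\<Sum>u\<in>S. indegree E ori u)"
        using that insert.prems(1) insert.hyps(1) finite_verts sum_indegree[of ori]
        by (subst sum_diff_nat) (auto simp: partial_orientations_def)
      also have "(\<Sum>u\<in>S. indegree E ori u) = (\<Sum>u\<in>S. r u)"
        using that by (simp add: partial_orientations_def)
      finally show ?thesis .
    qed
    show ?thesis
      unfolding partial_orientations_insert Diff
    proof (rule monomial_sum_coeff_ge)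
      show "half_plane_stable (partial_orientations r S) (indegree E) (V - S)"
        using partial_orientations_stable False insert.prems by simp
      show "indegree E ori v \<le> vertex_degree E ends v" if "ori \<in> partial_orientations r S" for ori
        using that indegree_le_degree by (simp add: partial_orientations_def)
      show "finite (partial_orientations r S)" "finite (V - S)" "v \<in> V - S"
        using finite_partial_orientations finite_verts v by auto
      show "x u > 0" if "u \<in> V - S - {v}" for u
        using that insert.prems by auto
    qed (fact hom, fact le)
  qed
  then show ?case
    unfolding prod.insert[OF insert.hyps] Diff by (simp only: J_def C_def mult.assoc)
qed

end

theorem theorem1p4:
  fixes V :: "'v set" and E :: "'e set" and ends :: "'e \<Rightarrow> 'v set" and r :: "'v \<Rightarrow> nat"
  assumes "finite_graph V E ends"
  shows "real (num_orientations V E ends r) \<ge>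
    (\<Prod>v\<in>V. real (vertex_degree E ends v choose r v)
        * (real (r v) / real (vertex_degree E ends v)) ^ r v
        * ((real (vertex_degree E ends v) - real (r v)) / real (vertex_degree E ends v))
            ^ (vertex_degree E ends v - r v))
    * (INF x\<in>{x :: 'v \<Rightarrow> real. \<forall>u\<in>V. x u > 0}.
        (\<Prod>e\<in>E. \<Sum>u\<in>ends e. x u) / (\<Prod>u\<in>V. x u ^ r u))"
    (is "_ \<ge> _ * (INF x\<in>?X. ?f x)")
proof -
  interpret finite_graph V E ends by (rule assms)
  define I where "I = (INF x\<in>?X. ?f x)"
  \<comment> \<open>A real infimum is a lower bound only for a set that is bounded below, here by
    \<open>0\<close>.\<close>
  have nonneg: "?f x \<ge> 0" if "x \<in> ?X" for x
    using that ends_subset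
    by (intro divide_nonneg_nonneg prod_nonneg sum_nonneg ballI) (auto intro!: less_imp_le)
  have "I * (\<Prod>v\<in>V. x v ^ r v) \<le> (\<Prod>e\<in>E. \<Sum>u\<in>ends e. x u)" if x: "\<forall>v\<in>V. x v > 0" for x
  proof -
    have "I \<le> ?f x"
      unfolding I_def using x nonneg by (intro cINF_lower bdd_belowI2[of _ 0]) auto
    moreover have "(\<Prod>v\<in>V. x v ^ r v) > 0"
      using x by (intro prod_pos) auto
    ultimately show ?thesis by (simp add: pos_le_divide_eq)
  qed
  \<comment> \<open>For \<open>S = V\<close> no variables remain, and the sum of empty products is
    the count.\<close>
  from partial_orientations_ge[OF this order_refl, of "\<lambda>_. 1"]
  have "(\<Prod>v\<in>V. capacity_factor (vertex_degree E ends v) (r v)) * I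
      \<le> real (card (partial_orientations r V))"
    by (simp add: monomial_sum_def)
  then show ?thesis
    by (simp add: I_def capacity_factor_def num_orientations_def partial_orientations_def)
qed

end
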